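(* Let $X$ be a metric space with a bicombing $\Gamma$. Then the following are equivalent: (1) there is a Banach space $B$ and an injective isometric $\Gamma$-affine map $f:X\to B$; (2) the $\Gamma$-affine functions $X\to\mathbb{R}$ separate the points of $X$ (for all $x\neq\bar x$ in $X$ there is a $\Gamma$-affine $f:X\to\mathbb{R}$ with $f(x)\neq f(\bar x)$); (3) there is a Banach space $B$ and an injective $\Gamma$-affine map $f:X\to B$.
   Context: A geodesic is an isometric embedding of an interval (arclength parametrized). A bicombing $\Gamma$ on a metric space $X$ assigns to each pair of points $x,y\in X$ a geodesic $\gamma_{xy}$ from $x$ to $y$ such that $\gamma_{yx}$ is $\gamma_{xy}$ with reversed orientation, and such that for every point $m$ on $\gamma_{xy}$ the geodesic $\gamma_{my}$ is the corresponding part of $\gamma_{xy}$ (no continuity in $x,y$ is required). Every normed vector space (in particular every Banach space and $\mathbb{R}$) is equipped with the natural bicombing $\gamma_{xy}(t)=x+t\frac{y-x}{\|y-x\|}$. A map $F:X\to Y$ between spaces with bicombings (both denoted $\Gamma$) is $\Gamma$-affine if for all $x,\bar x\in X$ there are numbers $a,b$ such that $F(\gamma_{x\bar x}(t))=\gamma_{F(x)F(\bar x)}(at+b)$ for all $t$ in the domain of $\gamma_{x\bar x}$. A $\Gamma$-affine function is a $\Gamma$-affine map $X\to\mathbb{R}$. *)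

theory Defs
  imports "HOL-Analysis.Analysis" "HOL-Probability.Discrete_Topology"
begin

definition geodesic_from_to :: "(real \<Rightarrow> 'a::metric_space) \<Rightarrow> 'a \<Rightarrow> 'a \<Rightarrow> bool" where
  "geodesic_from_to \<gamma> x y \<longleftrightarrow>
     \<gamma> 0 = x \<and> \<gamma> (dist x y) = y \<and>
     (\<forall>s\<in>{0..dist x y}. \<forall>t\<in>{0..dist x y}. dist (\<gamma> s) (\<gamma> t) = \<bar>s - t\<bar>)"

definition bicombing :: "('a::metric_space \<Rightarrow> 'a \<Rightarrow> real \<Rightarrow> 'a) \<Rightarrow> bool" where
  "bicombing \<Gamma> \<longleftrightarrow>
     (\<forall>x y. geodesic_from_to (\<Gamma> x y) x y) \<and>
     (\<forall>x y. \<forall>t\<in>{0..dist x y}. \<Gamma> y x t = \<Gamma> x y (dist x y - t)) \<and>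
     (\<forall>x y. \<forall>s\<in>{0..dist x y}. \<forall>t\<in>{0..dist x y - s}. \<Gamma> (\<Gamma> x y s) y t = \<Gamma> x y (s + t))"

definition linear_bicombing :: "'b::real_normed_vector \<Rightarrow> 'b \<Rightarrow> real \<Rightarrow> 'b" where
  "linear_bicombing x y t = x + (t / norm (y - x)) *\<^sub>R (y - x)"

definition gamma_affine ::
  "('a::metric_space \<Rightarrow> 'a \<Rightarrow> real \<Rightarrow> 'a) \<Rightarrow> ('b::metric_space \<Rightarrow> 'b \<Rightarrow> real \<Rightarrow> 'b)
     \<Rightarrow> ('a \<Rightarrow> 'b) \<Rightarrow> bool" where
  "gamma_affine \<Gamma> \<Gamma>' F \<longleftrightarrow>
     (\<forall>x x'. \<exists>a b. \<forall>t\<in>{0..dist x x'}.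
        a * t + b \<in> {0..dist (F x) (F x')} \<and> F (\<Gamma> x x' t) = \<Gamma>' (F x) (F x') (a * t + b))"

definition isometric_map :: "('a::metric_space \<Rightarrow> 'b::metric_space) \<Rightarrow> bool" where
  "isometric_map f \<longleftrightarrow> (\<forall>x y. dist (f x) (f y) = dist x y)"

text \<open>A concrete (large) Banach space used as the witness type:
  \<open>\<ell>\<^sup>\<infinity>\<close> over the index set of all real functions on X.\<close>
type_synonym 'a linfty = "('a \<Rightarrow> real) discrete \<Rightarrow>\<^sub>C real"

instance bcontfun :: (metric_space, banach) banach ..

end

theory Submission
  imports Defs "HOL-Library.Function_Algebras"
begin

text \<open>
  Injective \<open>\<Gamma>\<close>-affine maps into a vector space yield separating functions by composition with
  linear functionals, which need not be continuous.

  Conversely, if \<open>\<Gamma>\<close>-affine functions separate points, evaluating them identifies \<open>X\<close> with a convex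
  subset \<open>C\<close> of a vector space such that the metric \<open>d\<close> is proportional to the affine parameter on
  each segment. The crux is that parallel segments have the same length, so that \<open>d\<close> comes from a
  norm. For \<open>x\<^sub>s = x + s h\<close>, \<open>y\<^sub>s = x\<^sub>s + v\<close> and \<open>r s = d(x\<^sub>0, y\<^sub>s)\<close>, the triangle with vertices
  \<open>x\<^sub>0\<close>, \<open>y\<^sub>s\<close>, \<open>x\<^sub>s + 2 v\<close> gives \<open>2 r(s/2) \<le> r s + d(x\<^sub>s, y\<^sub>s)\<close>, because the midpoint of \<open>x\<^sub>0\<close> and
  \<open>x\<^sub>s + 2 v\<close> is \<open>y\<^sub>s\<^sub>/\<^sub>2\<close>. As \<open>r\<close> is Lipschitz, \<open>2 r(s/2) - r s \<ge> r 0 - e s\<close> for arbitrarily small \<open>s\<close>;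
  hence \<open>d(x\<^sub>s, y\<^sub>s)\<close> does not decrease in \<open>s\<close>, and by symmetry it is constant. Hahn-Banach then yields
  norming 1-Lipschitz affine functions, which are the coordinates of the isometric embedding.
\<close>

section \<open>A Hahn-Banach theorem for sublinear functionals\<close>

definition sublinear :: "('v::real_vector \<Rightarrow> real) \<Rightarrow> bool" where
  "sublinear p \<longleftrightarrow> (\<forall>x y. p (x + y) \<le> p x + p y) \<and> (\<forall>c\<ge>0. \<forall>x. p (c *\<^sub>R x) = c * p x)"

lemma sublinearI:
  assumes "\<And>x y. p (x + y) \<le> p x + p y"
    and "\<And>c x. c > 0 \<Longrightarrow> p (c *\<^sub>R x) \<le> c * p x"
    and "p 0 = 0"
  shows "sublinear p"
proof -
  have "p (c *\<^sub>R x) = c * p x" if "c \<ge> 0" for c x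
  proof (cases "c = 0")
    case True
    then show ?thesis using assms(3) by simp
  next
    case False
    then have c: "c > 0" using that by simp
    have "p x \<le> (1 / c) * p (c *\<^sub>R x)"
      using assms(2)[of "1 / c" "c *\<^sub>R x"] c by simp
    then have "c * p x \<le> p (c *\<^sub>R x)" using c by (simp add: field_simps)
    with assms(2)[OF c, of x] show ?thesis by simp
  qed
  then show ?thesis using assms(1) by (simp add: sublinear_def)
qed

lemma sublinear_add: "sublinear p \<Longrightarrow> p (x + y) \<le> p x + p y"
  and sublinear_scale: "sublinear p \<Longrightarrow> c \<ge> 0 \<Longrightarrow> p (c *\<^sub>R x) = c * p x"
  by (auto simp: sublinear_def)

lemma sublinear_zero: "sublinear p \<Longrightarrow> p 0 = 0"
  using sublinear_scale[of p 0 0] by simp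

lemma sublinear_neg: "sublinear p \<Longrightarrow> - p (- x) \<le> p x"
  using sublinear_add[of p x "- x"] sublinear_zero[of p] by simp

text \<open>Taking the infimum of \<open>p (x + t v) - t * p v\<close> over \<open>t \<ge> 0\<close>
  works: \<open>t = 0\<close> gives \<open>q \<le> p\<close>, and \<open>t = 1\<close> gives the
  bound at \<open>- v\<close>. It serves twice, to keep the value at \<open>v\<close> and to show
  that minimal functionals are odd.\<close>

lemma sublinear_flatten:
  assumes p: "sublinear p"
  shows "\<exists>q. sublinear q \<and> q \<le> p \<and> q (- v) \<le> - p v"
proof -
  define q where "q x = (INF t\<in>{0..}. p (x + t *\<^sub>R v) - t * p v)" for x
  \<comment> \<open>A lower bound free of \<open>t\<close>, so the infimum is finite.\<close>
  have bound: "- p (- x) \<le> p (x + t *\<^sub>R v) - t * p v" if "t \<ge> 0" for x t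
    using sublinear_add[OF p, of "x + t *\<^sub>R v" "- x"] sublinear_scale[OF p that, of v] by simp
  then have bdd: "bdd_below ((\<lambda>t. p (x + t *\<^sub>R v) - t * p v) ` {0..})" for x
    by (auto intro!: bdd_belowI2)
  have le: "q x \<le> p (x + t *\<^sub>R v) - t * p v" if "t \<ge> 0" for x t
    unfolding q_def using bdd that by (intro cINF_lower) auto
  have ge: "c \<le> q x" if "\<And>t. t \<ge> 0 \<Longrightarrow> c \<le> p (x + t *\<^sub>R v) - t * p v" for c x
    unfolding q_def using that by (intro cINF_greatest) auto
  have "sublinear q"
  proof (rule sublinearI)
    fix x y
    \<comment> \<open>Parameters \<open>s\<close> and \<open>t\<close> for the summands give
      \<open>s + t\<close> for the sum; the infima over \<open>t\<close> and \<open>s\<close> are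
      then taken one after the other.\<close>
    have "q (x + y) - (p (x + s *\<^sub>R v) - s * p v) \<le> p (y + t *\<^sub>R v) - t * p v"
      if "s \<ge> 0" "t \<ge> 0" for s t
      using le[of "s + t" "x + y"] that sublinear_add[OF p, of "x + s *\<^sub>R v" "y + t *\<^sub>R v"]
      by (simp add: algebra_simps)
    then have "q (x + y) - (p (x + s *\<^sub>R v) - s * p v) \<le> q y" if "s \<ge> 0" for s
      using ge that by blast
    then have "q (x + y) - q y \<le> q x"
      by (intro ge) (simp add: algebra_simps)
    then show "q (x + y) \<le> q x + q y" by simp
  next
    fix c :: real and x assume c: "c > 0"
    have "q (c *\<^sub>R x) / c \<le> p (x + t *\<^sub>R v) - t * p v" if "t \<ge> 0" for t
      using le[of "c * t" "c *\<^sub>R x"] that c sublinear_scale[OF p, of c "x + t *\<^sub>R v"]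
      by (simp add: field_simps scaleR_add_right)
    then have "q (c *\<^sub>R x) / c \<le> q x" by (rule ge)
    then show "q (c *\<^sub>R x) \<le> c * q x" using c by (simp add: field_simps)
  next
    show "q 0 = 0"
      using le[of 0 0] ge[of 0 0] sublinear_scale[OF p, of _ v] sublinear_zero[OF p] by simp
  qed
  moreover have "q x \<le> p x" for x using le[of 0 x] by simp
  moreover have "q (- v) \<le> - p v" using le[of 1 "- v"] sublinear_zero[OF p] by simp
  ultimately show ?thesis by (auto simp: le_fun_def)
qed

text \<open>Zorn's lemma applies, as the pointwise infimum of a chain is again sublinear;
  \<open>- p (- x)\<close> bounds it from below.\<close>

lemma minimal_sublinear:
  assumes p: "sublinear p"
  shows "\<exists>m. sublinear m \<and> m \<le> p \<and> (\<forall>q. sublinear q \<and> q \<le> m \<longrightarrow> q = m)"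
proof -
  define A where "A = {q. sublinear q \<and> q \<le> p}"
  \<comment> \<open>The order is reversed, so that the maximal element delivered by Zorn's lemma is
    pointwise minimal.\<close>
  define P where "P f g \<longleftrightarrow> g \<le> f" for f g :: "'a \<Rightarrow> real"
  have "\<exists>m\<in>A. \<forall>a\<in>A. P m a \<longrightarrow> a = m"
  proof (rule predicate_Zorn)
    show "partial_order_on A (relation_of P A)"
      by (rule partial_order_on_relation_ofI) (auto simp: P_def)
  next
    fix K assume "K \<in> Chains (relation_of P A)"
    then have KA: "K \<subseteq> A" and chain: "\<And>f g. f \<in> K \<Longrightarrow> g \<in> K \<Longrightarrow> f \<le> g \<or> g \<le> f"
      by (auto simp: Chains_def relation_of_def P_def)
    show "\<exists>u\<in>A. \<forall>a\<in>K. P a u"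
    proof (cases "K = {}")
      case True
      then show ?thesis using p by (auto simp: A_def)
    next
      case False
      define u where "u x = (INF f\<in>K. f x)" for x
      have sub: "sublinear f" and fp: "f \<le> p" if "f \<in> K" for f
        using that KA by (auto simp: A_def)
      have "- p (- x) \<le> f x" if "f \<in> K" for f x
        using sublinear_neg[OF sub[OF that], of x] fp[OF that] by (auto simp: le_fun_def intro: order_trans[rotated])
      then have bdd: "bdd_below ((\<lambda>f. f x) ` K)" for x
        by (auto intro!: bdd_belowI2)
      have le: "u x \<le> f x" if "f \<in> K" for f x
        unfolding u_def using bdd that by (intro cINF_lower) auto
      have ge: "c \<le> u x" if "\<And>f. f \<in> K \<Longrightarrow> c \<le> f x" for c x
        unfolding u_def using that False by (intro cINF_greatest) auto
      have "sublinear u"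
      proof (rule sublinearI)
        fix x y
        have "u (x + y) - f x \<le> g y" if fg: "f \<in> K" "g \<in> K" for f g
        proof -
          \<comment> \<open>Comparability in the chain puts one \<open>h\<close> below both
            \<open>f\<close> and \<open>g\<close>, and its subadditivity gives the estimate.\<close>
          obtain h where h: "h \<in> K" "h \<le> f" "h \<le> g"
            using chain[OF fg] fg by auto
          have "u (x + y) \<le> h x + h y"
            using le[OF h(1), of "x + y"] sublinear_add[OF sub[OF h(1)], of x y] by simp
          also have "\<dots> \<le> f x + g y" using h by (auto simp: le_fun_def intro: add_mono)
          finally show ?thesis by simp
        qed
        then have "u (x + y) - f x \<le> u y" if "f \<in> K" for f
          using ge that by blast
        then have "u (x + y) - u y \<le> u x" by (intro ge) (simp add: algebra_simps)
        then show "u (x + y) \<le> u x + u y" by simp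
      next
        fix c :: real and x assume c: "c > 0"
        have "u (c *\<^sub>R x) / c \<le> f x" if "f \<in> K" for f
          using le[OF that, of "c *\<^sub>R x"] sublinear_scale[OF sub[OF that], of c x] c
          by (simp add: field_simps)
        then have "u (c *\<^sub>R x) / c \<le> u x" by (rule ge)
        then show "u (c *\<^sub>R x) \<le> c * u x" using c by (simp add: field_simps)
      next
        have "(\<lambda>f. f 0) ` K = {0}" using False sublinear_zero[OF sub] by force
        then show "u 0 = 0" by (simp add: u_def)
      qed
      moreover have "u \<le> p"
        using False le fp by (fastforce simp: le_fun_def intro: order_trans)
      ultimately show ?thesis using le by (auto simp: A_def P_def le_fun_def)
    qed
  qed
  then show ?thesis
    by (auto simp: A_def P_def)
qed

text \<open>A minimal sublinear functional is odd, since flattening cannot lower it, and odd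
  sublinear functionals are linear. Flattening \<open>p\<close> at \<open>v\<close> beforehand keeps
  the value at \<open>v\<close>.\<close>

lemma hahn_banach_sublinear:
  fixes p :: "'v::real_vector \<Rightarrow> real"
  assumes p: "sublinear p"
  shows "\<exists>L. linear L \<and> (\<forall>x. L x \<le> p x) \<and> L v = p v"
proof -
  obtain q where q: "sublinear q" "q \<le> p" "q (- v) \<le> - p v"
    using sublinear_flatten[OF p] by blast
  obtain m where m: "sublinear m" "m \<le> q" and min: "\<And>r. sublinear r \<Longrightarrow> r \<le> m \<Longrightarrow> r = m"
    using minimal_sublinear[OF q(1)] by blast
  have neg: "m (- x) = - m x" for x
  proof -
    obtain r where r: "sublinear r" "r \<le> m" "r (- x) \<le> - m x"
      using sublinear_flatten[OF m(1)] by blast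
    then have "m (- x) \<le> - m x" using min by metis
    then show ?thesis using sublinear_neg[OF m(1), of x] by simp
  qed
  have "linear m"
  proof (rule linearI)
    fix x y
    show "m (x + y) = m x + m y"
      using sublinear_add[OF m(1), of x y] sublinear_add[OF m(1), of "- x" "- y"]
        neg[of x] neg[of y] neg[of "x + y"] by simp
  next
    fix c x
    show "m (c *\<^sub>R x) = c *\<^sub>R m x"
    proof (cases "c \<ge> 0")
      case True
      then show ?thesis using sublinear_scale[OF m(1)] by simp
    next
      case False
      then show ?thesis
        using sublinear_scale[OF m(1), of "- c" x] neg[of "c *\<^sub>R x"] by simp
    qed
  qed
  moreover have mp: "m x \<le> p x" for x using m(2) q(2) by (meson le_funD order_trans)
  moreover have "m v \<ge> p v" using neg[of v] m(2) q(3) by (smt (verit) le_funD)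
  ultimately show ?thesis using mp[of v] by (intro exI[of _ m]) auto
qed

section \<open>Parallel segments have equal length\<close>

text \<open>Continuous induction: the largest \<open>t\<close> with
  \<open>f a - e * (t - a) \<le> f t\<close> can only be \<open>b\<close>; then \<open>e\<close> is
  taken small.\<close>

lemma le_if_small_steps:
  fixes f :: "real \<Rightarrow> real"
  assumes "a \<le> b" and cont: "continuous_on {a..b} f"
    and step: "\<And>t e. a \<le> t \<Longrightarrow> t < b \<Longrightarrow> e > 0 \<Longrightarrow> \<exists>s. t < s \<and> s \<le> b \<and> f t - e * (s - t) \<le> f s"
  shows "f a \<le> f b"
proof -
  have "f a - e * (b - a) \<le> f b" if e: "e > 0" for e
  proof -
    define S where "S = {t \<in> {a..b}. f a \<le> f t + e * (t - a)}"
    have "closed S" unfolding S_def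
      by (intro continuous_closed_preimage_constant continuous_on_closed_Collect_le
          continuous_intros cont closed_atLeastAtMost)
    moreover have "S = {a..b} \<inter> S" by (auto simp: S_def)
    ultimately have "compact S" using compact_Int_closed[OF compact_Icc[of a b]] by metis
    moreover have "a \<in> S" using \<open>a \<le> b\<close> by (simp add: S_def)
    ultimately obtain t where t: "t \<in> S" and max: "\<And>s. s \<in> S \<Longrightarrow> s \<le> t"
      using compact_attains_sup[of S] by blast
    have "t = b"
    proof (rule ccontr)
      assume "t \<noteq> b"
      with t obtain s where s: "t < s" "s \<le> b" "f t - e * (s - t) \<le> f s"
        using step[OF _ _ e, of t] by (auto simp: S_def)
      then have "s \<in> S" using t by (auto simp: S_def algebra_simps)
      then show False using max s(1) by force
    qed
    then show ?thesis using t by (simp add: S_def)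
  qed
  note key = this
  show ?thesis
  proof (rule ccontr)
    assume less: "\<not> f a \<le> f b"
    then have "a < b" using \<open>a \<le> b\<close> by (metis order_le_less order_refl)
    \<comment> \<open>With this \<open>e\<close> the admissible loss is half of the supposed
      drop.\<close>
    define e where "e = (f a - f b) / 2 / (b - a)"
    have e: "e > 0" "e * (b - a) = (f a - f b) / 2"
      using less \<open>a < b\<close> unfolding e_def by (auto simp del: divide_divide_eq_left)
    show False using key[OF e(1)] less unfolding e(2) by (simp add: field_simps)
  qed
qed

text \<open>The difference quotients of \<open>r\<close> at \<open>0\<close> are bounded, so they cannot grow by a fixed amount at
  every halving of the step.\<close>

lemma small_second_difference:
  fixes r :: "real \<Rightarrow> real"
  assumes "\<delta> > 0" "e > 0" and K: "\<And>s. 0 < s \<Longrightarrow> s \<le> \<delta> \<Longrightarrow> \<bar>r s - r 0\<bar> \<le> K * s"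
  shows "\<exists>s. 0 < s \<and> s \<le> \<delta> \<and> r s - 2 * r (s / 2) + r 0 \<le> e * s"
proof (rule ccontr)
  assume neg: "\<not> ?thesis"
  define q where "q n = (r (\<delta> / 2 ^ n) - r 0) / (\<delta> / 2 ^ n)" for n :: nat
  have pos: "0 < \<delta> / 2 ^ n" "\<delta> / 2 ^ n \<le> \<delta>" for n :: nat
    using \<open>\<delta> > 0\<close> by (auto simp: field_simps)
  have dec: "q (Suc n) \<le> q n - e" for n
  proof -
    define s where "s = \<delta> / 2 ^ n"
    have s: "s > 0" "s \<le> \<delta>" and half: "\<delta> / 2 ^ Suc n = s / 2"
      using pos[of n] by (auto simp: s_def)
    \<comment> \<open>Divided by \<open>s\<close>, the second difference is exactly
      \<open>q n - q (Suc n)\<close>.\<close>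
    have "e * s \<le> r s - 2 * r (s / 2) + r 0" using neg s by force
    then have "s * (e * s) \<le> s * (r s - 2 * r (s / 2) + r 0)" using s by (intro mult_left_mono) auto
    then show ?thesis
      unfolding q_def half s_def[symmetric] using s by (simp add: field_simps)
  qed
  have "q n \<le> q 0 - n * e" for n
  proof (induction n)
    case (Suc n)
    then show ?case using dec[of n] by (simp add: algebra_simps)
  qed simp
  moreover have "\<bar>q n\<bar> \<le> K" for n
  proof -
    have "\<bar>x / z\<bar> \<le> K" if "z > 0" "\<bar>x\<bar> \<le> K * z" for x z :: real
      using that by (simp add: abs_divide pos_divide_le_eq)
    then show ?thesis using K[OF pos, of n] pos[of n] unfolding q_def by blast
  qed
  ultimately have "real n * e \<le> 2 * K" for n by (smt (verit))
  then show False
    using reals_Archimedean3[OF \<open>e > 0\<close>] by (meson not_le)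
qed

section \<open>Convex sets with a pseudometric proportional to the affine parameter\<close>

locale affine_pseudometric =
  fixes C :: "'v::real_vector set" and D :: "'v \<Rightarrow> 'v \<Rightarrow> real"
  assumes convex: "convex C"
    and sym: "a \<in> C \<Longrightarrow> b \<in> C \<Longrightarrow> D a b = D b a"
    and triangle: "a \<in> C \<Longrightarrow> b \<in> C \<Longrightarrow> c \<in> C \<Longrightarrow> D a c \<le> D a b + D b c"
    and segment: "a \<in> C \<Longrightarrow> b \<in> C \<Longrightarrow> 0 \<le> u \<Longrightarrow> u \<le> 1 \<Longrightarrow> D a (a + u *\<^sub>R (b - a)) = u * D a b"
begin

lemma segment_mem:
  assumes "a \<in> C" "b \<in> C" "0 \<le> u" "u \<le> 1"
  shows "a + u *\<^sub>R (b - a) \<in> C"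
  using convexD_alt[OF convex assms(1,2), of u] assms(3,4) by (simp add: algebra_simps)

lemma refl: "a \<in> C \<Longrightarrow> D a a = 0"
  using segment[of a a 0] by simp

lemma nonneg: "a \<in> C \<Longrightarrow> b \<in> C \<Longrightarrow> 0 \<le> D a b"
  using triangle[of a b a] sym[of a b] refl[of a] by simp

lemma midpoint:
  assumes "a \<in> C" "a + 2 *\<^sub>R w \<in> C"
  shows "a + w \<in> C" "D a (a + 2 *\<^sub>R w) = 2 * D a (a + w)" "D (a + w) (a + 2 *\<^sub>R w) = D a (a + w)"
proof -
  show m: "a + w \<in> C" and 1: "D a (a + 2 *\<^sub>R w) = 2 * D a (a + w)"
    using segment[OF assms, of "1/2"] segment_mem[OF assms, of "1/2"] by auto
  have "(1/2) *\<^sub>R (a - (a + 2 *\<^sub>R w)) = - w" by simp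
  then have eq: "a + 2 *\<^sub>R w + (1/2) *\<^sub>R (a - (a + 2 *\<^sub>R w)) = a + w"
    by (simp only:) (simp add: scaleR_2)
  show "D (a + w) (a + 2 *\<^sub>R w) = D a (a + w)"
    using segment[OF assms(2,1), of "1/2", unfolded eq] sym[OF assms] sym[OF m assms(2)] 1 by simp
qed

text \<open>The parallelogram has side \<open>2 v\<close>, twice the segment compared, so that the
  far vertices \<open>Z s\<close> of the triangles lie in \<open>C\<close>.\<close>

lemma parallel_le:
  assumes C: "x \<in> C" "x + h \<in> C" "x + 2 *\<^sub>R v \<in> C" "x + 2 *\<^sub>R v + h \<in> C"
  shows "D x (x + v) \<le> D (x + h) (x + h + v)"
proof -
  define X where "X s = x + s *\<^sub>R h" for s
  define Y where "Y s = X s + v" for s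
  define Z where "Z s = X s + 2 *\<^sub>R v" for s
  have X: "X s \<in> C" and Z: "Z s \<in> C" if "0 \<le> s" "s \<le> 1" for s
    using segment_mem[OF C(1,2) that] segment_mem[OF C(3,4) that]
    by (auto simp: X_def Z_def algebra_simps)
  have Y: "Y s \<in> C" if "0 \<le> s" "s \<le> 1" for s
    using midpoint(1)[of "X s" v] X[OF that] Z[OF that] by (simp add: Y_def Z_def)
  define K where "K = D (X 0) (X 1) + D (Y 0) (Y 1)"
  have lip: "D (a s) (a t) \<le> (t - s) * D (a 0) (a 1)"
    if a: "a = X \<or> a = Y" and st: "0 \<le> s" "s \<le> t" "t \<le> 1" for a s t
  proof (cases "t = 0")
    case True
    then show ?thesis using st refl[OF X, of 0] refl[OF Y, of 0] a by auto
  next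
    case False
    have aC: "a 0 \<in> C" "a 1 \<in> C" "a s \<in> C" "a t \<in> C" using a st X Y by auto
    have as: "a u = a 0 + u *\<^sub>R (a 1 - a 0)" for u
      using a by (auto simp: X_def Y_def)
    \<comment> \<open>Seen from \<open>a t\<close>, the point \<open>a s\<close> lies at the
      fraction \<open>1 - s / t\<close> of the way back to \<open>a 0\<close>, so
      \<open>segment\<close> applies twice.\<close>
    have "a t + (1 - s / t) *\<^sub>R (a 0 - a t) = a s"
      using False unfolding as[of t] as[of s]
      by (simp add: algebra_simps diff_divide_distrib)
    then have "D (a t) (a s) = (1 - s / t) * D (a t) (a 0)"
      using segment[OF aC(4,1), of "1 - s / t"] st False by (simp add: field_simps)
    also have "\<dots> = (1 - s / t) * (t * D (a 0) (a 1))"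
      using segment[OF aC(1,2), of t] as[of t] sym[OF aC(4,1)] st by simp
    also have "\<dots> = (t - s) * D (a 0) (a 1)" using False by (simp add: field_simps)
    finally show ?thesis using sym[OF aC(3,4)] by simp
  qed
  define g where "g s = D (X s) (Y s)" for s
  have quad: "\<bar>D a b - D a' b'\<bar> \<le> D a a' + D b b'" if "a \<in> C" "a' \<in> C" "b \<in> C" "b' \<in> C" for a a' b b'
    using triangle[of a a' b] triangle[of a' b' b] triangle[of a' a b'] triangle[of a b b'] that
      sym[of a a'] sym[of b b'] by simp
  have glip: "\<bar>g s - g t\<bar> \<le> K * (t - s)" if "0 \<le> s" "s \<le> t" "t \<le> 1" for s t
    using quad[of "X s" "X t" "Y s" "Y t"] X Y that lip[of X s t] lip[of Y s t]
    unfolding g_def K_def by (auto simp: algebra_simps)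
  have "g 0 \<le> g 1"
  proof (rule le_if_small_steps[where f = g])
    have "K-lipschitz_on {0..1} g"
    proof (rule lipschitz_onI)
      show "0 \<le> K" unfolding K_def using nonneg X Y by simp
      show "dist (g s) (g t) \<le> K * dist s t" if "s \<in> {0..1}" "t \<in> {0..1}" for s t
        using glip[of s t] glip[of t s] that by (cases "s \<le> t") (auto simp: dist_real_def)
    qed
    then show "continuous_on {0..1} g" by (rule lipschitz_on_continuous_on)
  next
    fix t e :: real assume t: "0 \<le> t" "t < 1" and e: "e > 0"
    \<comment> \<open>The triangle argument is run at every base \<open>t\<close>. Here
      \<open>r 0 = g t\<close>, and only the endpoint on \<open>Y\<close> moves, which bounds the
      growth of \<open>r\<close>.\<close>
    define r where "r s = D (X t) (Y (t + s))" for s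
    have "\<bar>r s - r 0\<bar> \<le> D (Y 0) (Y 1) * s" if "0 < s" "s \<le> 1 - t" for s
      using quad[of "X t" "X t" "Y (t + s)" "Y t"] refl[of "X t"] X[of t] Y[of t] Y[of "t + s"]
        lip[of Y t "t + s"] sym[of "Y t" "Y (t + s)"] t that
      unfolding r_def by (simp add: mult.commute)
    then obtain s where s: "0 < s" "s \<le> 1 - t" and rs: "r s - 2 * r (s / 2) + r 0 \<le> e * s"
      using small_second_difference[of "1 - t" e r "D (Y 0) (Y 1)"] t e by auto
    have mem: "X t \<in> C" "X (t + s) \<in> C" "Y (t + s) \<in> C" "Z (t + s) \<in> C"
      using X Y Z t s by auto
    \<comment> \<open>\<open>Y (t + s / 2)\<close> is the midpoint of \<open>X t\<close> and
      \<open>Z (t + s)\<close>.\<close>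
    have Zt: "Z (t + s) = X t + 2 *\<^sub>R (v + (s / 2) *\<^sub>R h)" "Y (t + s / 2) = X t + (v + (s / 2) *\<^sub>R h)"
      by (auto simp: X_def Y_def Z_def algebra_simps)
    have "2 * r (s / 2) = D (X t) (Z (t + s))"
      using midpoint(2)[of "X t" "v + (s / 2) *\<^sub>R h"] mem Zt unfolding r_def by simp
    also have "\<dots> \<le> r s + D (Y (t + s)) (Z (t + s))"
      using triangle[of "X t" "Y (t + s)" "Z (t + s)"] mem by (simp add: r_def)
    also have "D (Y (t + s)) (Z (t + s)) = g (t + s)"
      using midpoint(3)[of "X (t + s)" v] mem by (simp add: g_def Y_def Z_def)
    finally have "2 * r (s / 2) \<le> r s + g (t + s)" .
    moreover have "r 0 = g t" by (simp add: r_def g_def)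
    ultimately show "\<exists>s. t < s \<and> s \<le> 1 \<and> g t - e * (s - t) \<le> g s"
      using s rs by (intro exI[of _ "t + s"]) auto
  qed simp
  then show ?thesis by (simp add: g_def X_def Y_def)
qed

text \<open>\<open>parallel_le\<close> is applied to half of the given vector, and then again with
  the two segments exchanged.\<close>

lemma parallel:
  assumes C: "a \<in> C" "b \<in> C" "a' \<in> C" "b' \<in> C" and eq: "b - a = b' - a'"
  shows "D a b = D a' b'"
proof -
  have le: "D a b \<le> D a' b'" if C: "a \<in> C" "b \<in> C" "a' \<in> C" "b' \<in> C" and eq: "b - a = b' - a'"
    for a b a' b'
  proof -
    define v h where "v = (1/2) *\<^sub>R (b - a)" and "h = a' - a"
    have v: "2 *\<^sub>R v = b - a" by (simp add: v_def)
    have b: "a + 2 *\<^sub>R v = b" "a + h = a'" "a + 2 *\<^sub>R v + h = b'" "a' + 2 *\<^sub>R v = b'"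
      using eq unfolding v h_def by (auto simp: algebra_simps)
    have "D a (a + v) \<le> D a' (a' + v)"
      using parallel_le[of a h v] C b by simp
    then show ?thesis using midpoint(2)[of a v] midpoint(2)[of a' v] C b by simp
  qed
  show ?thesis using le[OF C eq] le[OF C(3,4,1,2) eq[symmetric]] by simp
qed

text \<open>By symmetry let \<open>c \<le> c'\<close>. Shrinking the first segment by
  \<open>c / c'\<close> stays inside \<open>C\<close> and makes it a translate of the
  second.\<close>

lemma scaled_parallel:
  assumes C: "a \<in> C" "b \<in> C" "a' \<in> C" "b' \<in> C" and c: "0 \<le> c" "0 \<le> c'"
    and eq: "c *\<^sub>R (b - a) = c' *\<^sub>R (b' - a')"
  shows "c * D a b = c' * D a' b'"
proof -
  have *: "c * D a b = c' * D a' b'"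
    if C: "a \<in> C" "b \<in> C" "a' \<in> C" "b' \<in> C" and c: "0 \<le> c" "c \<le> c'"
      and eq: "c *\<^sub>R (b - a) = c' *\<^sub>R (b' - a')" for a b a' b' c c'
  proof (cases "c' = 0")
    case True
    then show ?thesis using c by simp
  next
    case False
    then have "c' > 0" using c by simp
    define z where "z = a + (c / c') *\<^sub>R (b - a)"
    have "z \<in> C" "D a z = (c / c') * D a b"
      unfolding z_def using segment segment_mem C c \<open>c' > 0\<close> by auto
    moreover have "z - a = b' - a'"
    proof -
      have "z - a = (1 / c') *\<^sub>R (c *\<^sub>R (b - a))" by (simp add: z_def)
      also have "\<dots> = b' - a'" unfolding eq using \<open>c' > 0\<close> by simp
      finally show ?thesis .
    qed
    ultimately show ?thesis using parallel[of a z a' b'] C \<open>c' > 0\<close> by (simp add: field_simps)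
  qed
  show ?thesis
    using *[OF C, of c c'] *[OF C(3,4,1,2), of c' c] c eq by (cases "c \<le> c'") auto
qed

section \<open>The seminorm on the space of directions\<close>

definition seminorm :: "'v \<Rightarrow> real" where
  "seminorm v = (SOME r. \<exists>c\<ge>0. \<exists>a\<in>C. \<exists>b\<in>C. v = c *\<^sub>R (b - a) \<and> r = c * D a b)"

text \<open>The choice in \<open>seminorm\<close> is harmless: all representations of a vector give
  the same value by \<open>scaled_parallel\<close>.\<close>

lemma seminorm_eq:
  assumes "a \<in> C" "b \<in> C" "0 \<le> c"
  shows "seminorm (c *\<^sub>R (b - a)) = c * D a b"
  unfolding seminorm_def
proof (rule some_equality)
  show "\<exists>c'\<ge>0. \<exists>a'\<in>C. \<exists>b'\<in>C. c *\<^sub>R (b - a) = c' *\<^sub>R (b' - a') \<and> c * D a b = c' * D a' b'"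
    using assms by blast
next
  fix r assume "\<exists>c'\<ge>0. \<exists>a'\<in>C. \<exists>b'\<in>C. c *\<^sub>R (b - a) = c' *\<^sub>R (b' - a') \<and> r = c' * D a' b'"
  then show "r = c * D a b" using scaled_parallel assms by metis
qed

text \<open>The cone generated by the differences of points of \<open>C\<close>. Swapping endpoints
  gives negatives, so it turns out to be a subspace for nonempty \<open>C\<close>.\<close>

definition directions :: "'v set" where
  "directions = {v. \<exists>c\<ge>0. \<exists>a\<in>C. \<exists>b\<in>C. v = c *\<^sub>R (b - a)}"

lemma directionsE:
  assumes "v \<in> directions"
  obtains c a b where "0 \<le> c" "a \<in> C" "b \<in> C" "v = c *\<^sub>R (b - a)"
  using assms unfolding directions_def by blast

lemma directionsI: "0 \<le> c \<Longrightarrow> a \<in> C \<Longrightarrow> b \<in> C \<Longrightarrow> c *\<^sub>R (b - a) \<in> directions"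
  unfolding directions_def by blast

lemma directions_add:
  assumes "v \<in> directions" "w \<in> directions"
  shows "v + w \<in> directions \<and> seminorm (v + w) \<le> seminorm v + seminorm w"
proof -
  obtain c a b where v: "0 \<le> c" "a \<in> C" "b \<in> C" "v = c *\<^sub>R (b - a)"
    using assms(1) by (rule directionsE)
  obtain e a' b' where w: "0 \<le> e" "a' \<in> C" "b' \<in> C" "w = e *\<^sub>R (b' - a')"
    using assms(2) by (rule directionsE)
  show ?thesis
  proof (cases "c + e = 0")
    case True
    then have "v = 0" "w = 0" using v w by auto
    moreover have "0 \<in> directions" "seminorm 0 = 0"
      using directionsI[of 0 a a] seminorm_eq[of a a 0] v(2) by auto
    ultimately show ?thesis by simp
  next
    case False
    define k \<theta> where "k = c + e" and "\<theta> = e / k"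
    have k: "k > 0" "k * \<theta> = e" "k * (1 - \<theta>) = c" and \<theta>: "0 \<le> \<theta>" "\<theta> \<le> 1"
      using False v(1) w(1) by (auto simp: k_def \<theta>_def field_simps)
    \<comment> \<open>Convex combinations chosen so that \<open>P\<close>, \<open>Q\<close>,
      \<open>R\<close> form a triangle in \<open>C\<close> whose sides, scaled by \<open>k\<close>,
      are \<open>v\<close>, \<open>w\<close> and \<open>v + w\<close>.\<close>
    define P Q R where "P = a + \<theta> *\<^sub>R (a' - a)" and "Q = b + \<theta> *\<^sub>R (a' - b)" and "R = b + \<theta> *\<^sub>R (b' - b)"
    have mem: "P \<in> C" "Q \<in> C" "R \<in> C"
      unfolding P_def Q_def R_def using v w \<theta> by (auto intro!: segment_mem)
    have "k *\<^sub>R (Q - P) = (k * (1 - \<theta>)) *\<^sub>R (b - a)" "k *\<^sub>R (R - Q) = (k * \<theta>) *\<^sub>R (b' - a')"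
      by (auto simp: P_def Q_def R_def algebra_simps)
    then have PQ: "k *\<^sub>R (Q - P) = v" "k *\<^sub>R (R - Q) = w" using k v w by auto
    then have PR: "v + w = k *\<^sub>R (R - P)" by (auto simp: algebra_simps)
    have "seminorm (v + w) \<le> seminorm v + seminorm w"
      using seminorm_eq[of P R k] seminorm_eq[of P Q k] seminorm_eq[of Q R k] PQ PR mem k
        triangle[of P Q R] by (simp flip: distrib_left)
    then show ?thesis using PR directionsI[of k P R] mem k by simp
  qed
qed

lemma directions_scale:
  assumes "v \<in> directions" "0 \<le> c"
  shows "c *\<^sub>R v \<in> directions \<and> seminorm (c *\<^sub>R v) = c * seminorm v"
proof -
  obtain e a b where v: "0 \<le> e" "a \<in> C" "b \<in> C" "v = e *\<^sub>R (b - a)"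
    using assms(1) by (rule directionsE)
  have eq: "c *\<^sub>R v = (c * e) *\<^sub>R (b - a)" using v by simp
  show ?thesis
    unfolding eq using directionsI[of "c * e" a b] seminorm_eq[of a b "c * e"] seminorm_eq[of a b e] v assms by simp
qed

lemma subspace_directions:
  assumes "C \<noteq> {}"
  shows "subspace directions"
proof (rule subspaceI)
  show "0 \<in> directions" using assms directionsI[of 0] by auto
  show "v + w \<in> directions" if "v \<in> directions" "w \<in> directions" for v w
    using directions_add that by blast
  show "c *\<^sub>R v \<in> directions" if v: "v \<in> directions" for c v
  proof (cases "c \<ge> 0")
    case True
    then show ?thesis using directions_scale v by blast
  next
    case False
    obtain e a b where e: "0 \<le> e" "a \<in> C" "b \<in> C" and v: "v = e *\<^sub>R (b - a)"
      using v by (rule directionsE)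
    have "c *\<^sub>R v = (- c * e) *\<^sub>R (a - b)" unfolding v by (simp add: algebra_simps)
    then show ?thesis using e False directionsI[of "- c * e" b a] by (simp add: mult_nonpos_nonneg)
  qed
qed

lemma norming_functional:
  assumes pq: "p \<in> C" "q \<in> C"
  shows "\<exists>L. linear L \<and> L (q - p) = D p q \<and> (\<forall>a\<in>C. \<forall>b\<in>C. L (b - a) \<le> D a b)"
proof -
  have "subspace directions" using subspace_directions pq by blast
  \<comment> \<open>Hahn-Banach is stated on the whole space, so the seminorm is extended by a
    linear projection onto \<open>directions\<close>.\<close>
  then obtain \<pi> where \<pi>: "\<And>v. \<pi> v \<in> directions" "linear \<pi>" "\<And>v. v \<in> directions \<Longrightarrow> \<pi> v = v"
    using linear_exists_left_inverse_on[OF linear_ident, of directions] by auto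
  interpret \<pi>: linear \<pi> by fact
  define N where "N v = seminorm (\<pi> v)" for v
  have N: "N (b - a) = D a b" if "a \<in> C" "b \<in> C" for a b
    using \<pi>(3)[of "b - a"] directionsI[of 1 a b] seminorm_eq[of a b 1] that by (simp add: N_def)
  have "sublinear N"
    unfolding sublinear_def N_def
    using directions_add directions_scale \<pi>(1) by (simp add: \<pi>.add \<pi>.scaleR)
  from hahn_banach_sublinear[OF this, of "q - p"] show ?thesis using N pq by metis
qed

end

section \<open>Affine functions on spaces with bicombings\<close>

text \<open>Pointwise scalars turn functions into the real vector space that receives the evaluation
  map.\<close>

instantiation "fun" :: (type, real_vector) real_vector
begin

definition "c *\<^sub>R f = (\<lambda>x. c *\<^sub>R f x)"

instance
  by standard (auto simp: scaleR_fun_def plus_fun_def algebra_simps)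

end

section \<open>Affine maps in terms of the affine parameter\<close>

lemma bicombing_endpoints:
  assumes "bicombing \<Gamma>"
  shows "\<Gamma> x y 0 = x" "\<Gamma> x y (dist x y) = y"
  using assms by (auto simp: bicombing_def geodesic_from_to_def)

lemma bicombing_dist:
  assumes "bicombing \<Gamma>" "0 \<le> t" "t \<le> dist x y"
  shows "dist x (\<Gamma> x y t) = t"
proof -
  have "dist (\<Gamma> x y 0) (\<Gamma> x y t) = \<bar>0 - t\<bar>"
    using assms unfolding bicombing_def geodesic_from_to_def by (meson atLeastAtMost_iff order_refl zero_le_dist)
  then show ?thesis using bicombing_endpoints[OF assms(1)] assms(2) by simp
qed

text \<open>If \<open>F x \<noteq> F y\<close>, the endpoints determine the constants:
  \<open>t = 0\<close> forces \<open>b = 0\<close>, and \<open>t = dist x y\<close> forces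
  \<open>a * dist x y\<close> to be the distance of the images. This removes arclength from the
  target.\<close>

lemma gamma_affine_linear_iff:
  fixes F :: "'a::metric_space \<Rightarrow> 'b::real_normed_vector"
  assumes bc: "bicombing \<Gamma>"
  shows "gamma_affine \<Gamma> linear_bicombing F \<longleftrightarrow>
    (\<forall>x y. \<forall>u\<in>{0..1}. F (\<Gamma> x y (u * dist x y)) = F x + u *\<^sub>R (F y - F x))"
proof
  assume aff: "gamma_affine \<Gamma> linear_bicombing F"
  show "\<forall>x y. \<forall>u\<in>{0..1}. F (\<Gamma> x y (u * dist x y)) = F x + u *\<^sub>R (F y - F x)"
  proof (intro allI ballI)
    fix x y and u :: real assume u: "u \<in> {0..1}"
    obtain a b where ab: "\<And>t. t \<in> {0..dist x y} \<Longrightarrow> a * t + b \<in> {0..dist (F x) (F y)} \<and>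
        F (\<Gamma> x y t) = F x + ((a * t + b) / norm (F y - F x)) *\<^sub>R (F y - F x)"
      using aff unfolding gamma_affine_def linear_bicombing_def by metis
    have ud: "u * dist x y \<in> {0..dist x y}" using u by (auto intro: mult_left_le_one_le)
    show "F (\<Gamma> x y (u * dist x y)) = F x + u *\<^sub>R (F y - F x)"
    proof (cases "F x = F y")
      case True
      then show ?thesis using ab[OF ud] by simp
    next
      case False
      define n where "n = norm (F y - F x)"
      have n: "n > 0" using False by (simp add: n_def)
      have "(b / n) *\<^sub>R (F y - F x) = 0"
        using ab[of 0] bicombing_endpoints[OF bc] by (simp add: n_def)
      then have b: "b = 0" using False n by simp
      have "F y = F x + ((a * dist x y + b) / n) *\<^sub>R (F y - F x)"
        using ab[of "dist x y"] unfolding bicombing_endpoints[OF bc] n_def by simp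
      then have "((a * dist x y) / n) *\<^sub>R (F y - F x) = 1 *\<^sub>R (F y - F x)"
        unfolding b by (metis add.right_neutral add_diff_cancel_left' scaleR_one)
      then have "a * dist x y / n = 1" using False scaleR_cancel_right by (metis right_minus_eq)
      moreover have "(a * (u * dist x y) + b) / n = u * (a * dist x y / n)" using b by simp
      ultimately have "(a * (u * dist x y) + b) / n = u" by (metis mult.right_neutral)
      then show ?thesis using ab[OF ud] by (simp add: n_def)
    qed
  qed
next
  assume F: "\<forall>x y. \<forall>u\<in>{0..1}. F (\<Gamma> x y (u * dist x y)) = F x + u *\<^sub>R (F y - F x)"
  show "gamma_affine \<Gamma> linear_bicombing F"
    unfolding gamma_affine_def
  proof (intro allI)
    fix x y
    \<comment> \<open>For \<open>x = y\<close> this is 0 by the convention on division, and only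
      \<open>t = 0\<close> occurs.\<close>
    define a where "a = dist (F x) (F y) / dist x y"
    have "a * t + 0 \<in> {0..dist (F x) (F y)} \<and>
        F (\<Gamma> x y t) = linear_bicombing (F x) (F y) (a * t + 0)" if t: "t \<in> {0..dist x y}" for t
    proof (cases "x = y")
      case True
      then show ?thesis
        using t bicombing_endpoints[OF bc] by (simp add: linear_bicombing_def)
    next
      case False
      define u where "u = t / dist x y"
      have u: "u \<in> {0..1}" "u * dist x y = t" "a * t = u * dist (F x) (F y)"
        using t False by (auto simp: u_def a_def)
      have "F (\<Gamma> x y t) = F x + u *\<^sub>R (F y - F x)" using F u by metis
      then show ?thesis
        using u by (cases "F x = F y")
          (auto simp: linear_bicombing_def dist_norm norm_minus_commute mult_left_le_one_le)
    qed
    then show "\<exists>a b. \<forall>t\<in>{0..dist x y}. a * t + b \<in> {0..dist (F x) (F y)} \<and>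
        F (\<Gamma> x y t) = linear_bicombing (F x) (F y) (a * t + b)" by blast
  qed
qed

section \<open>The implications between the three conditions\<close>

lemma separating_if_injective:
  fixes f :: "'a::metric_space \<Rightarrow> 'b::real_normed_vector"
  assumes bc: "bicombing \<Gamma>" and inj: "inj f" and aff: "gamma_affine \<Gamma> linear_bicombing f"
    and "x \<noteq> y"
  shows "\<exists>g :: 'a \<Rightarrow> real. gamma_affine \<Gamma> linear_bicombing g \<and> g x \<noteq> g y"
proof -
  have "f x - f y \<noteq> 0" using inj \<open>x \<noteq> y\<close> by (auto dest: injD)
  \<comment> \<open>A nonzero vector extends to a basis, which yields a linear functional with value
    1 on it.\<close>
  then have "independent {f x - f y}" by simp
  then obtain L :: "'b \<Rightarrow> real" where L: "linear L" "L (f x - f y) = 1"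
    using linear_independent_extend[of "{f x - f y}" "\<lambda>_. 1 :: real"] by auto
  have "gamma_affine \<Gamma> linear_bicombing (\<lambda>z. L (f z))"
    using aff unfolding gamma_affine_linear_iff[OF bc]
    by (simp add: linear_add[OF L(1)] linear_diff[OF L(1)] linear_scale[OF L(1)])
  moreover have "L (f x) \<noteq> L (f y)" using L by (simp add: linear_diff)
  ultimately show ?thesis by blast
qed

text \<open>Transporting the metric to the image of the evaluation map gives an
  \<open>affine_pseudometric\<close>; its norming functional, composed with the evaluation, is the
  desired function.\<close>

lemma norming_affine_function:
  fixes \<Gamma> :: "'a::metric_space \<Rightarrow> 'a \<Rightarrow> real \<Rightarrow> 'a"
  assumes bc: "bicombing \<Gamma>"
    and sep: "\<And>x y. x \<noteq> y \<Longrightarrow> \<exists>g :: 'a \<Rightarrow> real. gamma_affine \<Gamma> linear_bicombing g \<and> g x \<noteq> g y"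
  shows "\<exists>g :: 'a \<Rightarrow> real. gamma_affine \<Gamma> linear_bicombing g \<and>
    (\<forall>a b. \<bar>g a - g b\<bar> \<le> dist a b) \<and> g y - g x = dist x y"
proof -
  \<comment> \<open>Evaluation at \<open>z\<close>. Coordinates at non-affine functions are set to
    0, where the affine identity is trivial.\<close>
  define J :: "'a \<Rightarrow> ('a \<Rightarrow> real) \<Rightarrow> real"
    where "J z \<phi> = (if gamma_affine \<Gamma> linear_bicombing \<phi> then \<phi> z else 0)" for z \<phi>
  have Jaff: "J (\<Gamma> a b (u * dist a b)) = J a + u *\<^sub>R (J b - J a)" if "0 \<le> u" "u \<le> 1" for a b u
    using that by (auto simp: J_def fun_eq_iff scaleR_fun_def gamma_affine_linear_iff[OF bc])
  have "inj J"
  proof (rule injI, rule ccontr)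
    fix a b assume "J a = J b" "a \<noteq> b"
    with sep[of a b] show False by (metis J_def)
  qed
  then have inv [simp]: "inv J (J z) = z" for z by simp
  define D where "D v w = dist (inv J v) (inv J w)" for v w
  interpret affine_pseudometric "range J" D
  proof
    show "convex (range J)"
      unfolding convex_alt
    proof (intro ballI allI impI)
      fix v w and u :: real assume "v \<in> range J" "w \<in> range J" and u: "0 \<le> u \<and> u \<le> 1"
      then obtain a b where "v = J a" "w = J b" by auto
      then have "(1 - u) *\<^sub>R v + u *\<^sub>R w = J (\<Gamma> a b (u * dist a b))"
        using Jaff u by (simp add: scaleR_diff_left scaleR_diff_right)
      then show "(1 - u) *\<^sub>R v + u *\<^sub>R w \<in> range J" by simp
    qed
  next
    fix v w and u :: real assume "v \<in> range J" "w \<in> range J" and u: "0 \<le> u" "u \<le> 1"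
    then obtain a b where "v = J a" "w = J b" by auto
    then show "D v (v + u *\<^sub>R (w - v)) = u * D v w"
      using Jaff[OF u, of a b, symmetric] bicombing_dist[OF bc, of "u * dist a b" a b] u
      by (simp add: D_def mult_left_le_one_le)
  qed (auto simp: D_def dist_commute dist_triangle)
  obtain L where L: "linear L" "L (J y - J x) = dist x y" "\<And>a b. L (J b - J a) \<le> dist a b"
    using norming_functional[of "J x" "J y"] by (auto simp: D_def)
  have "gamma_affine \<Gamma> linear_bicombing (\<lambda>z. L (J z))"
    unfolding gamma_affine_linear_iff[OF bc]
    by (simp add: Jaff linear_add[OF L(1)] linear_diff[OF L(1)] linear_scale[OF L(1)])
  moreover have "\<bar>L (J a) - L (J b)\<bar> \<le> dist a b" for a b
    using L(3)[of a b] L(3)[of b a] by (simp add: linear_diff[OF L(1)] dist_commute abs_le_iff)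
  moreover have "L (J y) - L (J x) = dist x y" using L by (simp add: linear_diff)
  ultimately show ?thesis by blast
qed

text \<open>Over a discrete index type every bounded function is bounded continuous, so
  \<open>linfty\<close> is the full space of bounded functions.\<close>

lemma continuous_on_discrete: "continuous_on S (f :: 'a discrete \<Rightarrow> 'b::topological_space)"
  unfolding continuous_on_open_invariant using open_discrete by blast

text \<open>A Kuratowski-type embedding with affine coordinates: these are 1-Lipschitz, so distances
  do not grow, and a norming one attains each distance.\<close>

lemma isometric_if_separating:
  fixes \<Gamma> :: "'a::metric_space \<Rightarrow> 'a \<Rightarrow> real \<Rightarrow> 'a"
  assumes bc: "bicombing \<Gamma>"
    and sep: "\<And>x y. x \<noteq> y \<Longrightarrow> \<exists>g :: 'a \<Rightarrow> real. gamma_affine \<Gamma> linear_bicombing g \<and> g x \<noteq> g y"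
  shows "\<exists>f :: 'a \<Rightarrow> 'a linfty. inj f \<and> isometric_map f \<and> gamma_affine \<Gamma> linear_bicombing f"
proof -
  define good where "good g \<longleftrightarrow> gamma_affine \<Gamma> linear_bicombing g \<and> (\<forall>a b. \<bar>g a - g b\<bar> \<le> dist a b)"
    for g :: "'a \<Rightarrow> real"
  \<comment> \<open>An arbitrary base point. Subtracting the value there bounds the coordinates of
    \<open>x\<close> by \<open>dist x o'\<close>; indices that are not \<open>good\<close>
    contribute 0.\<close>
  define o' :: 'a where "o' = undefined"
  define e where "e x \<phi> = (if good (of_discrete \<phi>) then of_discrete \<phi> x - of_discrete \<phi> o' else 0)" for x \<phi>
  define f :: "'a \<Rightarrow> 'a linfty" where "f x = Bcontfun (e x)" for x
  have "e x \<in> bcontfun" for x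
    by (rule bcontfun_normI[where b = "dist x o'"]) (auto simp: e_def good_def continuous_on_discrete)
  then have f: "apply_bcontfun (f x) = e x" for x
    by (simp add: f_def Bcontfun_inverse)
  have iso: "dist (f x) (f y) = dist x y" for x y
  proof (rule antisym)
    show "dist (f x) (f y) \<le> dist x y"
      by (rule dist_bound) (auto simp: f e_def good_def dist_real_def)
    obtain g where g: "good g" "g y - g x = dist x y"
      using norming_affine_function[OF bc sep] unfolding good_def by blast
    have "dist x y = dist (f x (discrete g)) (f y (discrete g))"
      using g zero_le_dist[of x y] unfolding g(2)[symmetric] f e_def dist_real_def
      by (simp add: discrete_inverse)
    also have "\<dots> \<le> dist (f x) (f y)" by (rule dist_bounded)
    finally show "dist x y \<le> dist (f x) (f y)" .
  qed
  have "gamma_affine \<Gamma> linear_bicombing f"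
    unfolding gamma_affine_linear_iff[OF bc]
  proof (intro allI ballI)
    fix x y and u :: real assume u: "u \<in> {0..1}"
    show "f (\<Gamma> x y (u * dist x y)) = f x + u *\<^sub>R (f y - f x)"
      by (rule bcontfun_eqI)
        (use u in \<open>auto simp: f e_def good_def gamma_affine_linear_iff[OF bc]\<close>)
  qed
  moreover have "inj f" using iso by (metis dist_eq_0_iff injI)
  ultimately show ?thesis using iso unfolding isometric_map_def by blast
qed

text \<open>Types cannot be quantified existentially, so the Banach space is an arbitrary
  \<open>'b\<close> where an embedding is assumed and the concrete \<open>'a linfty\<close> where
  one is constructed.\<close>

theorem theorem1p8:
  fixes \<Gamma> :: "'a::metric_space \<Rightarrow> 'a \<Rightarrow> real \<Rightarrow> 'a"
  assumes "bicombing \<Gamma>"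
  shows
    "((\<exists>f :: 'a \<Rightarrow> 'b::banach. inj f \<and> isometric_map f \<and> gamma_affine \<Gamma> linear_bicombing f)
        \<longrightarrow> (\<forall>x x'. x \<noteq> x' \<longrightarrow> (\<exists>g :: 'a \<Rightarrow> real. gamma_affine \<Gamma> linear_bicombing g \<and> g x \<noteq> g x')))
     \<and> ((\<exists>f :: 'a \<Rightarrow> 'b::banach. inj f \<and> gamma_affine \<Gamma> linear_bicombing f)
        \<longrightarrow> (\<forall>x x'. x \<noteq> x' \<longrightarrow> (\<exists>g :: 'a \<Rightarrow> real. gamma_affine \<Gamma> linear_bicombing g \<and> g x \<noteq> g x')))
     \<and> ((\<forall>x x'. x \<noteq> x' \<longrightarrow> (\<exists>g :: 'a \<Rightarrow> real. gamma_affine \<Gamma> linear_bicombing g \<and> g x \<noteq> g x'))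
        \<longrightarrow> (\<exists>f :: 'a \<Rightarrow> 'a linfty. inj f \<and> isometric_map f \<and> gamma_affine \<Gamma> linear_bicombing f)
          \<and> (\<exists>f :: 'a \<Rightarrow> 'a linfty. inj f \<and> gamma_affine \<Gamma> linear_bicombing f))"
  using separating_if_injective[OF assms] isometric_if_separating[OF assms] by blast

end
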